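(* Let $\mathcal{V} = \{1, 2, 2^2, 2^3, \dots\} \cup \{-1, -2, -2^2, -2^3, \dots\} \subseteq \mathbb{Z}$ and let $U \subseteq \mathbb{Z}_{\leq -1}$ be the infinite set defined in the context. Write $U = \{-u_1, -u_2, -u_3, \dots\}$ where $u_1 < u_2 < u_3 < \cdots$. Define $U^{(1)} = U$ and for each integer $i \geq 1$ define $$U^{(i+1)} := \begin{cases} U^{(i)} \setminus \{-u_i\} & \text{if } (U^{(i)} \setminus \{-u_i\}) + \mathcal{V} = \mathbb{Z},\\ U^{(i)} & \text{otherwise.}\end{cases}$$ Let $\mathcal{U} = \bigcap_{i\geq 1} U^{(i)}$. Then $(\mathcal{U}, \mathcal{V})$ is a co-minimal pair in $\mathbb{Z}$.
   Context: For nonempty subsets $A, B$ of an abelian group $(G,+)$, write $A + B = \{a+b \mid a\in A, b\in B\}$, and $x + A = \{x\} + A$, $A - x = A + \{-x\}$ for $x \in G$. The pair $(A,B)$ is called a co-minimal pair in $G$ if $A + B = G$, $A' + B \subsetneq G$ for every $\emptyset \neq A' \subsetneq A$, and $A + B' \subsetneq G$ for every $\emptyset \neq B' \subsetneq B$. Definition of $U$. Define subsets $U_n$ ($n\geq 0$) of $\mathbb{Z}$ by $U_0 = \{-2,-1\}$, $U_1 = U_2 = \emptyset$, $U_3 = \{6\} - (1+2^4)$, $U_4 = \{3,4,14\} - (1+2^5)$, and for $n \geq 5$, $$U_n = \Big(\big(2^{n-3} + \{1,2,\dots,2^{n-3}\}\big) \cup \big(2^{n-1}+2^{n-2} + \{1,2,\dots,2^{n-4}\}\big)\Big)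 - (1+2^{n+1}).$$ Then $U = \bigcup_{n\geq 0} U_n$. *)

theory Defs
  imports Complex_Main "HOL-Library.Set_Algebras" "HOL-Library.Infinite_Set"
begin

text \<open>Throughout, \<open>+\<close> on sets is the Minkowski sum of \<open>HOL-Library.Set_Algebras\<close>,
  whereas \<open>-\<close> on sets is always set difference; the translate of \<open>A\<close> by \<open>-x\<close> is
  therefore written \<open>A + {- x}\<close>.\<close>

definition co_minimal_pair :: "'a::ab_group_add set \<Rightarrow> 'a set \<Rightarrow> bool" where
  "co_minimal_pair A B \<longleftrightarrow>
     A \<noteq> {} \<and> B \<noteq> {} \<and> A + B = UNIV \<and>
     (\<forall>A'. A' \<noteq> {} \<and> A' \<subset> A \<longrightarrow> A' + B \<subset> UNIV) \<and>
     (\<forall>B'. B' \<noteq> {} \<and> B' \<subset> B \<longrightarrow> A + B' \<subset> UNIV)"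

definition U_seg :: "nat \<Rightarrow> int set" where
  "U_seg n =
     (if n = 0 then {-2, -1}
      else if n = 1 \<or> n = 2 then {}
      else if n = 3 then {6} + {- (1 + 2 ^ 4)}
      else if n = 4 then {3, 4, 14} + {- (1 + 2 ^ 5)}
      else (({2 ^ (n - 3)} + {1..2 ^ (n - 3)})
            \<union> ({2 ^ (n - 1) + 2 ^ (n - 2)} + {1..2 ^ (n - 4)}))
           + {- (1 + 2 ^ (n + 1))})"

definition U_set :: "int set" where
  "U_set = (\<Union>n. U_seg n)"

definition V_set :: "int set" where
  "V_set = {2 ^ k |k :: nat. True} \<union> {- (2 ^ k) |k :: nat. True}"

text \<open>Greedy deletion of the points \<open>- u 1, - u 2, \<dots>\<close> from \<open>A\<close>. The stages are indexed
  from 1, and the first deletion happens in the passage from stage 1 to stage 2;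
  stage 0 is a dummy.\<close>

primrec greedy_prune :: "int set \<Rightarrow> int set \<Rightarrow> (nat \<Rightarrow> int) \<Rightarrow> nat \<Rightarrow> int set" where
  "greedy_prune A B u 0 = A"
| "greedy_prune A B u (Suc i) =
     (if 1 \<le> i \<and> (greedy_prune A B u i - {- u i}) + B = UNIV
      then greedy_prune A B u i - {- u i}
      else greedy_prune A B u i)"

lemma greedy_prune_1: "greedy_prune A B u 1 = A"
  by simp

lemma U_seg_less_0:
  assumes "x \<in> U_seg n"
  shows "x \<le> -1"
proof (cases "n \<le> 4")
  case True
  then show ?thesis using assms
    by (auto simp: U_seg_def set_plus_def split: if_splits)
next
  case False
  then obtain m where n: "n = m + 5"
    using le_Suc_ex[of 5 n] by (auto simp: add.commute)
  have "(1::int) \<le> 2 ^ m" by simp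
  with assms show ?thesis
    by (auto simp: U_seg_def set_plus_def n power_add split: if_splits)
qed

lemma infinite_U_set: "infinite U_set"
proof
  assume "finite U_set"
  then obtain b where b: "\<And>x. x \<in> U_set \<Longrightarrow> \<bar>x\<bar> \<le> b"
    by (meson finite_imageI Max_ge finite_imageI imageI)
  define m where "m = nat b"
  have "2 ^ (m + 2) + 1 + - (1 + 2 ^ (m + 6)) \<in> U_seg (m + 5)"
  proof -
    have "(1::int) \<le> 2 ^ (m + 2)" by (rule one_le_power) simp
    then have mem: "1 \<in> {1..2 ^ (m + 2) :: int}"
      unfolding atLeastAtMost_iff by blast
    have idx: "m + 5 - 3 = m + 2" "m + 5 + 1 = m + 6"
      "(m + 5 = 0) = False" "(m + 5 = 1) = False" "(m + 5 = 2) = False"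
      "(m + 5 = 3) = False" "(m + 5 = 4) = False"
      by simp_all
    show ?thesis
      unfolding U_seg_def idx simp_thms if_False
      by (intro set_plus_intro UnI1 singletonI mem)
  qed
  then have "2 ^ (m + 2) + 1 + - (1 + 2 ^ (m + 6)) \<in> U_set"
    unfolding U_set_def by blast
  from b[OF this] have "60 * 2 ^ m \<le> b"
    by (simp add: power_add)
  moreover have "b < 2 ^ m"
    using of_nat_less_two_power[of m, where 'a = int] by (simp add: m_def split: if_splits)
  moreover have "(1::int) \<le> 2 ^ m" by simp
  ultimately show False by linarith
qed

text \<open>An increasing enumeration as assumed in the main statement exists.\<close>

lemma U_set_enumeration_exists:
  "\<exists>u :: nat \<Rightarrow> int. strict_mono_on {1..} u \<and> U_set = {- u i |i. 1 \<le> i}"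
proof -
  define S where "S = {k. - int k \<in> U_set}"
  have U: "U_set = (\<lambda>k. - int k) ` S"
  proof (intro subset_antisym subsetI)
    fix x assume x: "x \<in> U_set"
    then have "x \<le> -1" by (auto simp: U_set_def dest: U_seg_less_0)
    then have "x = - int (nat (- x))" by simp
    with x show "x \<in> (\<lambda>k. - int k) ` S" unfolding S_def by (metis imageI mem_Collect_eq)
  qed (auto simp: S_def)
  have inf: "infinite S" using infinite_U_set U finite_imageI by metis
  define u where "u i = int (enumerate S (i - 1))" for i
  have "strict_mono_on {1..} u"
    using inf by (auto simp: strict_mono_on_def u_def)
  moreover have "U_set = {- u i |i. 1 \<le> i}"
  proof -
    have "{- u i |i. 1 \<le> i} = (\<lambda>k. - int k) ` range (enumerate S)"
    proof (intro subset_antisym subsetI)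
      fix x assume "x \<in> (\<lambda>k. - int k) ` range (enumerate S)"
      then obtain j where "x = - u (Suc j)" by (auto simp: u_def)
      then show "x \<in> {- u i |i. 1 \<le> i}" by force
    qed (auto simp: u_def)
    then show ?thesis using U range_enumerate[OF inf] by simp
  qed
  ultimately show ?thesis by blast
qed

end

theory Submission
  imports Defs
begin

text \<open>
  The proof has three independent parts, two arithmetical and one a compactness argument.

  \<^item> Apart from the six sporadic values $1, 2, 11, 19, 29, 30$, the negatives of the elements of
  \<open>U\<close> are the integers in the intervals $(19q, 20q]$ and $(28q, 30q]$ for $q = 2, 4, 8, \ldots$,
  two intervals in each dyadic range $(16q, 32q]$. An integer $z$ lies in $U + V$ exactly when
  $w - z$ belongs to this set for some $w = \pm 2^j$. The intervals are placed so that this always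
  happens (lemma \<open>U_plus_V\<close>): an integer $z \ge 4$ is $2^k$ minus an element of an
  interval of the form $(28q, 30q]$, and for $z = -y$ with $y \in (16q, 32q]$, $q \ge 2$, the position
  of $y/q$ in $(16, 32]$ tells which power of two, $1$ or a fixed multiple of $q$, has to be added
  to or subtracted from $y$ in order to reach an interval.

  \<^item> No element of \<open>U\<close> has its negative in the gaps $(20q, 28q]$ and $(30q, 38q]$, for $q$ any
  power of two. The second gap
  surrounds the power of two $32q$, so for fixed $z$ no large $\pm 2^j$ can occur in a representation
  $z = u + v$, and $z$ has only finitely many representations. Hence a decreasing sequence of sets
  $S_i \subseteq U$ with $S_i + V = \mathbb{Z}$ has an intersection with the same
  property (lemma \<open>Inter_sum_eq_UNIV\<close>): the sets cannot lose all
  representations of $z$ in the limit without losing them at a finite stage. This gives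
  $\mathcal{U} + V = \mathbb{Z}$. Minimality in the first factor is built into the greedy
  procedure: a point that survives was indispensable when it was examined, and
  only fewer points are left in the limit.

  \<^item> Minimality in the second factor is already a property of \<open>U\<close>, not only of the smaller set
  $\mathcal{U}$. For each $v \in V$ some integer $z$ can be written as $u + w$ with $u \in U$, $w \in V$
  only with $w = v$ (lemma \<open>V_element_forced\<close>). For $v = 2^{m+6}$ one can take $z = 2^{m+2}$, for
  $v = -2^{m+3}$ one can take $z = -17 \cdot 2^{m+2}$; every other $w = \pm 2^j$ puts $w - z$ into a gap,
  makes it nonpositive, or gives one of the numbers $4$, $8$ and $12$. The remaining nine values of $v$ are handled by individual $z$.
\<close>

section \<open>The shape of \<open>U\<close>\<close>

text \<open>The two intervals that form $-U_n$ for $n \ge 5$, in the unit $q = 2^{n-4}$, a 32nd of the modulus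
  $2^{n+1}$ from which $U_n$ is measured; in this unit all end points are integers.\<close>

definition block :: "int \<Rightarrow> int \<Rightarrow> bool" where
  "block q x \<longleftrightarrow> 19 * q < x \<and> x \<le> 20 * q \<or> 28 * q < x \<and> x \<le> 30 * q"

lemma translate_interval: "{a::int} + {1..b} + {- (1 + c)} = {a - c..a + b - 1 - c}"
proof (intro set_eqI iffI)
  fix x assume "x \<in> {a - c..a + b - 1 - c}"
  then have "x - a + 1 + c \<in> {1..b}" and "x = (a + (x - a + 1 + c)) + (- (1 + c))"
    by auto
  then show "x \<in> {a} + {1..b} + {- (1 + c)}"
    by (metis set_plus_intro singletonI)
qed (auto simp: set_plus_def)

lemma U_seg_ge5: "- x \<in> U_seg (m + 5) \<longleftrightarrow> block (2 ^ (m + 1)) x"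
proof -
  have idx: "m + 5 - 1 = m + 4" "m + 5 - 2 = m + 3" "m + 5 - 3 = m + 2" "m + 5 - 4 = m + 1"
      "m + 5 + 1 = m + 6"
      "(m + 5 = 0) = False" "(m + 5 = 1) = False" "(m + 5 = 2) = False"
      "(m + 5 = 3) = False" "(m + 5 = 4) = False"
    by simp_all
  have un: "(A \<union> B) + C = (A + C) \<union> (B + C)" for A B C :: "int set"
    by (auto simp: set_plus_def)
  show ?thesis
    unfolding U_seg_def idx simp_thms if_False un translate_interval block_def
    by (auto simp: power_add)
qed

lemma minus_mem_U_set:
  "- x \<in> U_set \<longleftrightarrow> x \<in> {1, 2, 11, 19, 29, 30} \<or> (\<exists>m. block (2 ^ (m + 1)) x)"
proof -
  have split: "(\<exists>n. P n) \<longleftrightarrow> P 0 \<or> P 1 \<or> P 2 \<or> P 3 \<or> P 4 \<or> (\<exists>m. P (m + 5))" for P :: "nat \<Rightarrow> bool"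
  proof -
    have "n = 0 \<or> n = 1 \<or> n = 2 \<or> n = 3 \<or> n = 4 \<or> (\<exists>m. n = m + 5)" for n :: nat
      by presburger
    then show ?thesis by metis
  qed
  have seg: "- x \<in> U_seg 0 \<longleftrightarrow> x \<in> {1, 2}" "- x \<notin> U_seg 1" "- x \<notin> U_seg 2"
    "- x \<in> U_seg 3 \<longleftrightarrow> x = 11" "- x \<in> U_seg 4 \<longleftrightarrow> x \<in> {19, 29, 30}"
    by (auto simp: U_seg_def set_plus_def)
  have "- x \<in> U_set \<longleftrightarrow> (\<exists>n. - x \<in> U_seg n)"
    by (simp add: U_set_def)
  also have "\<dots> \<longleftrightarrow> x \<in> {1, 2, 11, 19, 29, 30} \<or> (\<exists>m. block (2 ^ (m + 1)) x)"
    by (subst split) (use seg U_seg_ge5 in auto)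
  finally show ?thesis .
qed

lemma block_imp_mem: "1 \<le> m \<Longrightarrow> block (2 ^ m) x \<Longrightarrow> - x \<in> U_set"
  unfolding minus_mem_U_set by (metis Suc_eq_plus1 Suc_le_D One_nat_def)

text \<open>The exponent $0$ is covered as well, because the sporadic values $29$ and $30$ fill the upper
  interval for $q = 1$. The lower interval $\{20\}$ for $q = 1$ has no such replacement.\<close>

lemma upper_block_imp_mem: "28 * 2 ^ m < x \<Longrightarrow> x \<le> 30 * 2 ^ m \<Longrightarrow> - x \<in> U_set"
proof (cases "m = 0")
  case True
  assume "28 * 2 ^ m < x" "x \<le> 30 * 2 ^ m"
  with True have "x = 29 \<or> x = 30" by auto
  then show ?thesis by (auto simp: minus_mem_U_set)
qed (auto simp: block_def intro!: block_imp_mem[of m])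

lemma minus_mem_U_set_pos: "- x \<in> U_set \<Longrightarrow> 0 < x"
  using U_seg_less_0 by (force simp: U_set_def)

text \<open>Two powers of two are equal or differ by a factor of at least two. Comparing a scale with the
  scale of a block in this way reduces each gap statement to linear arithmetic.\<close>

lemma power_two_trichotomy:
  fixes m n :: nat
  defines "p \<equiv> (2::int) ^ m" and "q \<equiv> 2 ^ n"
  shows "p = q \<or> 2 * p \<le> q \<or> 2 * q \<le> p"
proof -
  have "2 * (2::int) ^ i \<le> 2 ^ j" if "i < j" for i j :: nat
    using power_increasing[of "Suc i" j "2::int"] that by simp
  then show ?thesis
    unfolding p_def q_def by (metis linorder_neqE_nat)
qed

text \<open>The space between the two intervals of the block of scale $2^m$.\<close>

lemma lower_gap:
  assumes "20 * 2 ^ m < x" "x \<le> 28 * 2 ^ m"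
  shows "- x \<notin> U_set"
proof
  assume "- x \<in> U_set"
  moreover have "x \<notin> {1, 2, 11, 19, 29, 30}"
  proof -
    have "(1::int) \<le> 2 ^ m" by simp
    then have "(2::int) ^ m = 1 \<or> 2 \<le> (2::int) ^ m"
      using power_two_trichotomy[of 0 m, unfolded power_0] by linarith
    with assms show ?thesis by auto
  qed
  ultimately obtain n where "block (2 ^ (n + 1)) x"
    unfolding minus_mem_U_set by blast
  with assms power_two_trichotomy[of m "n + 1"] show False
    unfolding block_def by linarith
qed

text \<open>The space between the blocks of the consecutive scales $2^m$ and $2^{m+1}$: the latter
  starts after $19 \cdot 2^{m+1}$. It contains the power of two $32 \cdot 2^m$ and a
  neighbourhood of proportional size.\<close>

lemma upper_gap:
  assumes "30 * 2 ^ m < x" "x \<le> 38 * 2 ^ m"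
  shows "- x \<notin> U_set"
proof
  assume "- x \<in> U_set"
  moreover have "x \<notin> {1, 2, 11, 19, 29, 30}"
  proof -
    have "(1::int) \<le> 2 ^ m" by simp
    with assms have "30 < x" by linarith
    then show ?thesis by auto
  qed
  ultimately obtain n where "block (2 ^ (n + 1)) x"
    unfolding minus_mem_U_set by blast
  with assms power_two_trichotomy[of m "n + 1"] show False
    unfolding block_def by linarith
qed

text \<open>A decision procedure for small elements: $304 = 19 \cdot 16$ is where the block of scale $16$ begins.\<close>

lemma small_mem_U_set:
  assumes "x \<le> 304"
  shows "- x \<in> U_set \<longleftrightarrow>
    x \<in> {1, 2, 11, 19, 29, 30} \<or> block 2 x \<or> block 4 x \<or> block 8 x"
proof -
  have "m \<in> {0, 1, 2}" if "block (2 ^ (m + 1)) x" for m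
  proof (rule ccontr)
    assume "m \<notin> {0, 1, 2}"
    then have "3 \<le> m" by auto
    then have "(2::int) ^ 4 \<le> 2 ^ (m + 1)"
      by (intro power_increasing) auto
    with that assms show False
      unfolding block_def by auto
  qed
  moreover have "block (2 ^ (0 + 1)) x = block 2 x" "block (2 ^ (1 + 1)) x = block 4 x"
    "block (2 ^ (2 + 1)) x = block 8 x"
    by simp_all
  ultimately have "(\<exists>m. block (2 ^ (m + 1)) x) \<longleftrightarrow> block 2 x \<or> block 4 x \<or> block 8 x"
    by (metis insertE singletonD)
  then show ?thesis
    unfolding minus_mem_U_set by simp
qed

lemma power_two_not_mem_U_set: "2 \<le> m \<Longrightarrow> - (2 ^ m) \<notin> U_set"
proof (cases "5 \<le> m")
  case True
  then obtain i where "m = i + 5" by (metis add.commute le_Suc_ex)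
  then show ?thesis by (intro upper_gap[of i]) (auto simp: power_add)
next
  case False
  assume "2 \<le> m"
  with False have "m = 2 \<or> m = 3 \<or> m = 4" by auto
  then show ?thesis by (auto simp: small_mem_U_set block_def)
qed

section \<open>Representations of an integer\<close>

lemma V_set_cases:
  assumes "v \<in> V_set"
  obtains j where "v = 2 ^ j" | j where "v = - (2 ^ j)"
  using assms by (auto simp: V_set_def)

lemma V_setI: "2 ^ j \<in> V_set" "- (2 ^ j) \<in> V_set"
  by (auto simp: V_set_def)

lemma mem_sumI: "- (v - z) \<in> U_set \<Longrightarrow> v \<in> V_set \<Longrightarrow> z \<in> U_set + V_set"
  by (metis set_plus_intro diff_add_cancel minus_diff_eq)

text \<open>For large $j$ the number $2^j - z$ is so close to $2^j = 32q$ that it falls into the gap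
  $(30q, 38q]$, while $-2^j - z$ is negative.\<close>

lemma large_power_not_representing:
  assumes "- (6 * 2 ^ m) \<le> z" "z < 2 * 2 ^ m" "m + 5 \<le> j"
  shows "- (2 ^ j - z) \<notin> U_set" "- (- (2 ^ j) - z) \<notin> U_set"
proof -
  obtain i where j: "j = m + i + 5" using assms(3) by (metis add.assoc add.commute le_Suc_ex)
  define q :: int where "q = 2 ^ (m + i)"
  have q: "2 ^ m \<le> q" unfolding q_def by (intro power_increasing) auto
  have j': "2 ^ j = 32 * q" by (simp add: j q_def power_add)
  show "- (2 ^ j - z) \<notin> U_set"
    by (rule upper_gap[of "m + i"]; fold q_def; use assms q j' in linarith)
  show "- (- (2 ^ j) - z) \<notin> U_set"
  proof
    assume "- (- (2 ^ j) - z) \<in> U_set"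
    from minus_mem_U_set_pos[OF this] assms q j' show False
      using zero_le_power[of "2::int" m] by linarith
  qed
qed

lemma finite_representations: "finite {v \<in> V_set. z - v \<in> U_set}"
proof -
  define m where "m = nat \<bar>z\<bar>"
  have "\<bar>z\<bar> < 2 ^ m"
    using of_nat_less_two_power[of m, where 'a = int] by (simp add: m_def)
  then have b: "- (6 * 2 ^ m) \<le> z" "z < 2 * 2 ^ m" by linarith+
  have "{v \<in> V_set. z - v \<in> U_set} \<subseteq> (\<lambda>j. 2 ^ j) ` {..<m + 5} \<union> (\<lambda>j. - (2 ^ j)) ` {..<m + 5}"
  proof
    fix v assume "v \<in> {v \<in> V_set. z - v \<in> U_set}"
    then have v: "v \<in> V_set" "- (v - z) \<in> U_set" by auto
    from v(1) show "v \<in> (\<lambda>j. 2 ^ j) ` {..<m + 5} \<union> (\<lambda>j. - (2 ^ j)) ` {..<m + 5}"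
    proof (cases rule: V_set_cases)
      case (1 j)
      with v(2) large_power_not_representing(1)[OF b, of j] have "j < m + 5"
        by (meson not_le)
      with 1 show ?thesis by auto
    next
      case (2 j)
      with v(2) large_power_not_representing(2)[OF b, of j] have "j < m + 5"
        by (meson not_le)
      with 2 show ?thesis by auto
    qed
  qed
  then show ?thesis by (rule finite_subset) auto
qed

lemma dyadic_bracket:
  assumes "(1::int) \<le> y"
  obtains k where "2 ^ k \<le> y" "y < 2 * 2 ^ k"
proof -
  have "1 \<le> nat y" using assms by simp
  then obtain k where k: "2 ^ k \<le> nat y" "nat y < 2 ^ (k + 1)"
    using ex_power_ivl1[OF order.refl, of "nat y"] by blast
  have "int (2 ^ k) \<le> int (nat y)" "int (nat y) < int (2 ^ (k + 1))"
    using k by (simp_all only: of_nat_le_iff of_nat_less_iff)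
  with assms show thesis by (intro that[of k]) auto
qed

text \<open>The numbers $2^{m+5} - x$ with $x$ in the upper interval $(28 \cdot 2^m, 30 \cdot 2^m]$ fill
  the dyadic range $[2^{m+1}, 2^{m+2})$.\<close>

lemma U_plus_V_nonneg:
  assumes "0 \<le> z"
  shows "z \<in> U_set + V_set"
proof (cases "4 \<le> z")
  case True
  then obtain k where k: "2 ^ k \<le> z" "z < 2 * 2 ^ k" using dyadic_bracket[of z] by auto
  have "k \<noteq> 0" using k True by (intro notI) simp
  then obtain m where m: "k = m + 1" by (metis Suc_eq_plus1 not0_implies_Suc)
  show ?thesis
    by (rule mem_sumI[OF _ V_setI(1)[of "m + 5"]], rule upper_block_imp_mem[of m])
      (use k in \<open>auto simp: m power_add\<close>)
next
  case False
  with assms have "z = 0 \<or> z = 1 \<or> z = 2 \<or> z = 3" by auto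
  then show ?thesis
    using mem_sumI[OF _ V_setI(1)[of 0], of 0] mem_sumI[OF _ V_setI(1)[of 1], of 1]
      mem_sumI[OF _ V_setI(1)[of 2], of 2] mem_sumI[OF _ V_setI(1)[of 2], of 3]
    by (auto simp: small_mem_U_set)
qed

text \<open>Here the argument for larger $y$ breaks down, because it uses the interval $(19q, 20q]$ at a
  scale $q \ge 2$. The cases collect the $y$ that are served by the same element of \<open>V\<close>.\<close>

lemma U_plus_V_small_neg:
  assumes "1 \<le> y" "y \<le> 32"
  shows "- y \<in> U_set + V_set"
proof -
  have "y \<in> set [1..32]" using assms by simp
  then consider "y \<in> {1, 10, 18, 29}"
    | "y \<in> {2, 3, 12, 20, 30, 31}"
    | "y \<in> {9, 17}"
    | "y \<in> {4, 13, 21, 32}"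
    | "y \<in> {5, 6, 15, 23}"
    | "y \<in> {11, 22}"
    | "y \<in> {19}"
    | "y \<in> {14, 24}"
    | "y \<in> {7, 8, 25, 26, 27, 28}"
    | "y \<in> {16}"
    by (simp del: set_upto add: upto_rec1[of 1]; elim disjE; simp)
  then show ?thesis
  proof cases
    case 1
    then show ?thesis
      by (intro mem_sumI[OF _ V_setI(1)[of 0]]) (auto simp: small_mem_U_set block_def)
  next
    case 2
    then show ?thesis
      by (intro mem_sumI[OF _ V_setI(2)[of 0]]) (auto simp: small_mem_U_set block_def)
  next
    case 3
    then show ?thesis
      by (intro mem_sumI[OF _ V_setI(1)[of 1]]) (auto simp: small_mem_U_set block_def)
  next
    case 4
    then show ?thesis
      by (intro mem_sumI[OF _ V_setI(2)[of 1]]) (auto simp: small_mem_U_set block_def)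
  next
    case 5
    then show ?thesis
      by (intro mem_sumI[OF _ V_setI(2)[of 2]]) (auto simp: small_mem_U_set block_def)
  next
    case 6
    then show ?thesis
      by (intro mem_sumI[OF _ V_setI(1)[of 3]]) (auto simp: small_mem_U_set block_def)
  next
    case 7
    then show ?thesis
      by (intro mem_sumI[OF _ V_setI(2)[of 3]]) (auto simp: small_mem_U_set block_def)
  next
    case 8
    then show ?thesis
      by (intro mem_sumI[OF _ V_setI(1)[of 4]]) (auto simp: small_mem_U_set block_def)
  next
    case 9
    then show ?thesis
      by (intro mem_sumI[OF _ V_setI(1)[of 5]]) (auto simp: small_mem_U_set block_def)
  next
    case 10
    then show ?thesis
      by (intro mem_sumI[OF _ V_setI(1)[of 6]]) (auto simp: small_mem_U_set block_def)
  qed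
qed

text \<open>Up to scaling, the position of $y$ in a dyadic range decides which power of two to add or
  subtract. Some positions need the upper interval of the previous scale, so the unit $c$ is
  chosen as half of the unit of the dyadic range that contains $y$.\<close>

lemma U_plus_V_large_neg:
  assumes "33 \<le> y"
  shows "- y \<in> U_set + V_set"
proof -
  obtain k where k: "2 ^ k \<le> y - 1" "y - 1 < 2 * 2 ^ k"
    using dyadic_bracket[of "y - 1"] assms by auto
  have "\<not> k < 5"
  proof
    assume "k < 5"
    then have "(2::int) ^ k \<le> 2 ^ 4" by (intro power_increasing) auto
    with k assms show False by simp
  qed
  then obtain n where n: "k = n + 5" by (metis add.commute le_Suc_ex not_less)
  define c :: int where "c = 2 ^ n"
  have y: "32 * c < y" "y \<le> 64 * c" and c: "1 \<le> c"
    using k by (auto simp: n c_def power_add)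
  have mem: "- x \<in> U_set"
    if "28 * c < x \<and> x \<le> 30 * c \<or> 56 * c < x \<and> x \<le> 60 * c \<or> 38 * c < x \<and> x \<le> 40 * c" for x
    using that upper_block_imp_mem[of n x] block_imp_mem[of "n + 1" x]
    by (auto simp: c_def block_def)
  have "2 ^ 0 \<in> V_set" "- (2 ^ 0) \<in> V_set" "2 ^ (n + i) \<in> V_set" "- (2 ^ (n + i)) \<in> V_set" for i
    by (rule V_setI)+
  from this(1,2) this(3,4)[of 1] this(3,4)[of 2] this(3,4)[of 3] this(3,4)[of 4] this(3,4)[of 5]
  have V: "1 \<in> V_set" "- 1 \<in> V_set" "2 * c \<in> V_set" "4 * c \<in> V_set" "- (4 * c) \<in> V_set"
    "8 * c \<in> V_set" "- (8 * c) \<in> V_set" "16 * c \<in> V_set" "- (16 * c) \<in> V_set" "- (32 * c) \<in> V_set"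
    by (simp_all add: power_add c_def mult.commute)
  have rep: "- y \<in> U_set + V_set"
    if "w \<in> V_set" "28 * c < y + w \<and> y + w \<le> 30 * c \<or> 56 * c < y + w \<and> y + w \<le> 60 * c
      \<or> 38 * c < y + w \<and> y + w \<le> 40 * c" for w
    using mem_sumI[of w "- y"] mem[of "y + w"] that by (simp add: add.commute)
  consider "y \<le> 34 * c" | "34 * c < y" "y \<le> 36 * c" | "36 * c < y" "y \<le> 38 * c"
    | "38 * c < y" "y < 40 * c" | "y = 40 * c" | "40 * c < y" "y \<le> 44 * c"
    | "44 * c < y" "y \<le> 46 * c" | "46 * c < y" "y \<le> 48 * c" | "48 * c < y" "y \<le> 52 * c"
    | "52 * c < y" "y \<le> 56 * c" | "56 * c < y" "y < 60 * c" | "y = 60 * c"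
    | "60 * c < y" "y \<le> 62 * c" | "62 * c < y"
    using le_less_linear[of y "34 * c"] le_less_linear[of y "36 * c"]
      le_less_linear[of y "38 * c"] le_less_linear[of y "44 * c"]
      le_less_linear[of y "46 * c"] le_less_linear[of y "48 * c"]
      le_less_linear[of y "52 * c"] le_less_linear[of y "56 * c"]
      le_less_linear[of y "62 * c"] linorder_less_linear[of y "40 * c"]
      linorder_less_linear[of y "60 * c"]
    by blast
  then show ?thesis
  proof cases
    case 1 then show ?thesis by (intro rep[of "- (4 * c)"] V) (use y in linarith)
  next
    case 2 then show ?thesis by (intro rep[of "4 * c"] V) linarith
  next
    case 3 then show ?thesis by (intro rep[of "2 * c"] V) linarith
  next
    case 4 then show ?thesis by (intro rep[of 1] V) linarith
  next
    \<comment> \<open>At the end point of an interval, a step of one has to go down instead of up; it stays inside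
      because the interval has length at least two.\<close>
    case 5 then show ?thesis by (intro rep[of "- 1"] V) (use c in linarith)
  next
    case 6 then show ?thesis by (intro rep[of "16 * c"] V) linarith
  next
    case 7 then show ?thesis by (intro rep[of "- (16 * c)"] V) linarith
  next
    case 8 then show ?thesis by (intro rep[of "- (8 * c)"] V) linarith
  next
    case 9 then show ?thesis by (intro rep[of "8 * c"] V) linarith
  next
    case 10 then show ?thesis by (intro rep[of "4 * c"] V) linarith
  next
    case 11 then show ?thesis by (intro rep[of 1] V) linarith
  next
    case 12 then show ?thesis by (intro rep[of "- 1"] V) (use c in linarith)
  next
    case 13 then show ?thesis by (intro rep[of "- (32 * c)"] V) linarith
  next
    case 14 then show ?thesis by (intro rep[of "- (4 * c)"] V) (use y in linarith)
  qed
qed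

lemma U_plus_V: "U_set + V_set = UNIV"
proof -
  have "z \<in> U_set + V_set" for z
    using U_plus_V_nonneg[of z] U_plus_V_small_neg[of "- z"] U_plus_V_large_neg[of "- z"] by force
  then show ?thesis by blast
qed

section \<open>Every element of \<open>V\<close> is indispensable\<close>

text \<open>Such a \<open>z\<close> witnesses that \<open>v\<close> cannot be removed from \<open>V\<close>. The first summand $z - w$ is written as
  the negative of $w - z$ because \<open>U\<close> is described through its negatives.\<close>

definition forces :: "int \<Rightarrow> int \<Rightarrow> bool" where
  "forces z v \<longleftrightarrow> (\<forall>w \<in> V_set. - (w - z) \<in> U_set \<longrightarrow> w = v)"

lemma forcesI:
  assumes "\<And>j. - (2 ^ j - z) \<in> U_set \<Longrightarrow> 2 ^ j = v"
    and "\<And>j. - (- (2 ^ j) - z) \<in> U_set \<Longrightarrow> - (2 ^ j) = v"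
  shows "forces z v"
  using assms by (auto simp: forces_def elim!: V_set_cases)

text \<open>In the unit $p = 2^m$ the numbers $2^j - z$ are $4p, 12p, 28p, 60p$ for $j = m+3, \ldots, m+6$;
  the first is a power of two, the next two lie in lower gaps (except $12p = 12$ for $p = 1$), and only $60p$, the top of an upper
  interval, is a candidate. Smaller $j$ give nonpositive numbers and larger $j$ lead to an upper gap.\<close>

lemma forces_positive_power: "forces (2 ^ (m + 2)) (2 ^ (m + 6))"
proof (rule forcesI)
  fix j
  define p :: int where "p = 2 ^ m"
  have p: "0 < p" by (simp add: p_def)
  have z: "(2::int) ^ (m + 2) = 4 * p" by (simp add: p_def power_add)
  show "(2::int) ^ j = 2 ^ (m + 6)" if mem: "- (2 ^ j - 2 ^ (m + 2)) \<in> U_set"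
  proof -
    have "\<not> j \<le> m + 2"
    proof
      assume "j \<le> m + 2"
      then have "(2::int) ^ j \<le> 2 ^ (m + 2)" by (intro power_increasing) auto
      with minus_mem_U_set_pos[OF mem] show False by simp
    qed
    then obtain i where j: "j = m + 3 + i" using le_Suc_ex[of "m + 3" j] by auto
    have pow: "(2::int) ^ j = 8 * 2 ^ i * p" by (simp add: j p_def power_add)
    have "i \<noteq> 0"
    proof
      assume "i = 0"
      with mem pow z have "- (2 ^ (m + 2)) \<in> U_set" by simp
      then show False using power_two_not_mem_U_set[of "m + 2"] by simp
    qed
    moreover have "i \<noteq> 1"
    proof
      assume "i = 1"
      with mem pow z have mem': "- (12 * p) \<in> U_set" by simp
      show False
      proof (cases m)
        case 0
        with mem' show False by (simp add: p_def small_mem_U_set block_def)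
      next
        case (Suc n)
        with mem' lower_gap[of n "12 * p"] show False by (simp add: p_def)
      qed
    qed
    moreover have "i \<noteq> 2"
      using mem pow z p lower_gap[of m "28 * p"] by (auto simp: p_def)
    moreover have "\<not> 4 \<le> i"
      using mem p z j large_power_not_representing(1)[of "m + 2" "2 ^ (m + 2)" j] by auto
    ultimately have "i = 3" by linarith
    then show ?thesis by (simp add: j)
  qed
  show "- (2 ^ j) = (2::int) ^ (m + 6)" if "- (- (2 ^ j) - 2 ^ (m + 2)) \<in> U_set"
    using minus_mem_U_set_pos[OF that] zero_le_power[of "2::int" j] p z by linarith
qed

text \<open>In the unit $c = 2^m$ the relevant numbers are $68c \pm 2^j$. If $2^j \le 2c$, they stay in the gap
  $(60c, 76c]$ around $64c$, and for $2^j \ge 512c$ they are in the gap next to $2^j$ or negative. For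
  the seven powers between, all values meet one of finitely many gaps, except $68c - 8c = 60c$.\<close>

lemma forces_negative_power: "forces (- (17 * 2 ^ (m + 2))) (- (2 ^ (m + 3)))"
proof (rule forcesI)
  fix j
  define c :: int where "c = 2 ^ m"
  have c: "0 < c" by (simp add: c_def)
  have z: "- (17 * 2 ^ (m + 2)) = - (68 * c)" by (simp add: c_def power_add)
  have gaps: "\<not> (60 * c < x \<and> x \<le> 76 * c)" "\<not> (30 * c < x \<and> x \<le> 38 * c)"
    "\<not> (120 * c < x \<and> x \<le> 152 * c)" "\<not> (40 * c < x \<and> x \<le> 56 * c)"
    "\<not> (80 * c < x \<and> x \<le> 112 * c)" "\<not> (160 * c < x \<and> x \<le> 224 * c)"
    "\<not> (320 * c < x \<and> x \<le> 448 * c)" "x \<noteq> 4 * c" "0 < x"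
    if "- x \<in> U_set" for x
    using that upper_gap[of m x] upper_gap[of "m + 1" x] upper_gap[of "m + 2" x]
      lower_gap[of "m + 1" x] lower_gap[of "m + 2" x] lower_gap[of "m + 3" x]
      lower_gap[of "m + 4" x] power_two_not_mem_U_set[of "m + 2"] minus_mem_U_set_pos[of x]
    by (auto simp: c_def power_add)
  consider "2 ^ j \<le> 2 * c" | i where "j = m + 2 + i" "i < 7" | "m + 9 \<le> j"
  proof (cases "j \<le> m + 1")
    case True
    then have "(2::int) ^ j \<le> 2 ^ (m + 1)" by (intro power_increasing) auto
    then show thesis by (intro that(1)) (simp add: c_def)
  next
    case False
    then obtain i where "j = m + 2 + i" using le_Suc_ex[of "m + 2" j] by auto
    then show thesis using that(2)[of i] that(3) by linarith
  qed
  note cases_j = this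
  have pow: "(2::int) ^ (m + 2 + i) = 4 * 2 ^ i * c" for i
    by (simp add: c_def power_add)
  have small: "i = 0 \<or> i = 1 \<or> i = 2 \<or> i = 3 \<or> i = 4 \<or> i = 5 \<or> i = 6" if "i < 7" for i :: nat
    using that by linarith
  have pos: "0 < (2::int) ^ j" by simp
  show "(2::int) ^ j = - (2 ^ (m + 3))" if mem: "- (2 ^ j - (- (17 * 2 ^ (m + 2)))) \<in> U_set"
    using cases_j
  proof cases
    case 1
    then show ?thesis using gaps(1)[OF mem[unfolded z]] pos by linarith
  next
    case (2 i)
    from small[OF 2(2)] show ?thesis
      using gaps[OF mem[unfolded z 2(1) pow]] c by (elim disjE) simp_all
  next
    case 3
    then show ?thesis
      using mem c large_power_not_representing(1)[of "m + 4" "- (17 * 2 ^ (m + 2))" j]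
      by (simp add: c_def power_add)
  qed
  show "- (2 ^ j) = - ((2::int) ^ (m + 3))" if mem: "- (- (2 ^ j) - (- (17 * 2 ^ (m + 2)))) \<in> U_set"
    using cases_j
  proof cases
    case 1
    then show ?thesis using gaps(1)[OF mem[unfolded z]] pos by linarith
  next
    case (2 i)
    have "i = 1"
      using small[OF 2(2)] gaps[OF mem[unfolded z 2(1) pow]] c by (elim disjE) simp_all
    with 2 show ?thesis by (simp add: numeral_3_eq_3)
  next
    case 3
    then show ?thesis
      using mem c large_power_not_representing(2)[of "m + 4" "- (17 * 2 ^ (m + 2))" j]
      by (simp add: c_def power_add)
  qed
qed

text \<open>For small $z$ only the powers below $2^8$ matter, so that the claim becomes a finite check.\<close>

lemma forces_smallI:
  assumes "- 48 \<le> z" "z < 16"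
    and "\<forall>j \<in> {0, 1, 2, 3, 4, 5, 6, 7}. - (2 ^ j - z) \<in> U_set \<longrightarrow> 2 ^ j = v"
    and "\<forall>j \<in> {0, 1, 2, 3, 4, 5, 6, 7}. - (- (2 ^ j) - z) \<in> U_set \<longrightarrow> - (2 ^ j) = v"
  shows "forces z v"
proof (rule forcesI)
  fix j :: nat
  have small: "j \<in> {0, 1, 2, 3, 4, 5, 6, 7}" if "\<not> 8 \<le> j"
    using that by auto
  show "2 ^ j = v" if "- (2 ^ j - z) \<in> U_set"
  proof (rule assms(3)[rule_format, OF small that])
    show "\<not> 8 \<le> j"
      using that assms(1,2) large_power_not_representing(1)[of 3 z j] by force
  qed
  show "- (2 ^ j) = v" if "- (- (2 ^ j) - z) \<in> U_set"
  proof (rule assms(4)[rule_format, OF small that])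
    show "\<not> 8 \<le> j"
      using that assms(1,2) large_power_not_representing(2)[of 3 z j] by force
  qed
qed

lemma nonneg_not_mem_U_set: "0 \<le> x \<Longrightarrow> x \<notin> U_set"
  using minus_mem_U_set_pos[of "- x"] by auto

text \<open>The powers that are too small for the two families above.\<close>

lemma forces_small:
  "forces (- 2) (- 1)" "forces (- 4) (- 2)" "forces (- 6) (- 4)"
  "forces (- 1) 1" "forces 1 2" "forces (- 36) 4" "forces (- 11) 8" "forces (- 24) 16"
  "forces (- 8) 32"
  by (rule forces_smallI; simp add: small_mem_U_set nonneg_not_mem_U_set block_def)+

lemma V_element_forced:
  assumes "v \<in> V_set"
  shows "\<exists>z. forces z v"
  using assms
proof (cases rule: V_set_cases)
  case (1 j)
  consider "j = 0" | "j = 1" | "j = 2" | "j = 3" | "j = 4" | "j = 5" | m where "j = m + 6"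
    using le_Suc_ex[of 6 j] by (force simp: add.commute)
  then show ?thesis
    using forces_small forces_positive_power by cases (auto simp: 1)
next
  case (2 j)
  consider "j = 0" | "j = 1" | "j = 2" | m where "j = m + 3"
    using le_Suc_ex[of 3 j] by (force simp: add.commute)
  then show ?thesis
    using forces_small forces_negative_power by cases (auto simp: 2)
qed

section \<open>Greedy deletion\<close>

text \<open>Compactness: if $z$ were lost in the limit, the finitely many summands $b$ that occur in
  representations of $z$ over $S_0$ would each become useless at some stage, hence all of them at one common stage, where $z$ is still
  represented.\<close>

lemma Inter_sum_eq_UNIV:
  fixes S :: "nat \<Rightarrow> 'a::ab_group_add set"
  assumes "antimono S" and cover: "\<And>i. S i + B = UNIV"
    and fin: "\<And>z. finite {b \<in> B. z - b \<in> S 0}"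
  shows "(\<Inter>i. S i) + B = UNIV"
proof -
  have "z \<in> (\<Inter>i. S i) + B" for z
  proof (rule ccontr)
    assume z: "z \<notin> (\<Inter>i. S i) + B"
    define F where "F = {b \<in> B. z - b \<in> S 0}"
    have "\<exists>i. z - b \<notin> S i" if "b \<in> F" for b
    proof (rule ccontr)
      assume "\<nexists>i. z - b \<notin> S i"
      then have "(z - b) + b \<in> (\<Inter>i. S i) + B"
        using that by (intro set_plus_intro) (auto simp: F_def)
      with z show False by simp
    qed
    then obtain f where f: "z - b \<notin> S (f b)" if "b \<in> F" for b by metis
    have "finite (f ` F)" using fin[of z] by (simp add: F_def)
    then obtain M where M: "f b \<le> M" if "b \<in> F" for b
      using Max_ge[of "f ` F"] by blast
    from cover[of M] obtain a b where ab: "a \<in> S M" "b \<in> B" "z = a + b"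
      by (metis UNIV_I set_plus_elim)
    with antimonoD[OF \<open>antimono S\<close>, of 0 M] have b: "b \<in> F" by (auto simp: F_def)
    with antimonoD[OF \<open>antimono S\<close> M[OF b]] f[OF b] ab show False by auto
  qed
  then show ?thesis by blast
qed

lemma antimono_greedy_prune: "antimono (greedy_prune A B u)"
  unfolding decseq_Suc_iff by auto

lemma greedy_prune_sum: "A + B = UNIV \<Longrightarrow> greedy_prune A B u i + B = UNIV"
  by (induction i) auto

lemma greedy_limit:
  assumes "A + B = UNIV" and "\<And>z. finite {b \<in> B. z - b \<in> A}"
  shows "(\<Inter>i\<in>{1..}. greedy_prune A B u i) + B = UNIV"
proof -
  have "(\<Inter>i. greedy_prune A B u i) + B = UNIV"
    using assms by (intro Inter_sum_eq_UNIV antimono_greedy_prune greedy_prune_sum) auto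
  moreover have "(\<Inter>i. greedy_prune A B u i) \<subseteq> (\<Inter>i\<in>{1..}. greedy_prune A B u i)"
    by auto
  ultimately show ?thesis
    using set_plus_mono2[OF _ order.refl] by (metis top.extremum_uniqueI)
qed

text \<open>A point of the limit that is missing in \<open>A'\<close> survived its own examination, so the stage at that
  time without this point, which contains \<open>A'\<close>, did not suffice.\<close>

lemma greedy_limit_minimal:
  assumes "A = {- u i |i. 1 \<le> i}" and "A' \<subset> (\<Inter>i\<in>{1..}. greedy_prune A B u i)"
  shows "A' + B \<noteq> UNIV"
proof
  assume full: "A' + B = UNIV"
  obtain a where a: "a \<in> (\<Inter>i\<in>{1..}. greedy_prune A B u i)" "a \<notin> A'"
    using assms(2) by blast
  then have "a \<in> greedy_prune A B u 1" by blast
  then obtain i where i: "1 \<le> i" "a = - u i"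
    unfolding greedy_prune_1 assms(1) by auto
  have "A' \<subseteq> greedy_prune A B u i - {- u i}"
    using assms(2) a i by auto
  then have "(greedy_prune A B u i - {- u i}) + B = UNIV"
    using full set_plus_mono2[OF _ order.refl, of A' _ B] by blast
  then have "a \<notin> greedy_prune A B u (Suc i)"
    using i by simp
  moreover have "a \<in> greedy_prune A B u (Suc i)"
    by (rule INT_D[OF a(1)]) simp
  ultimately show False by blast
qed

lemma V_minimal:
  assumes "A \<subseteq> U_set" "B' \<subset> V_set"
  shows "A + B' \<noteq> UNIV"
proof
  assume full: "A + B' = UNIV"
  obtain v where v: "v \<in> V_set" "v \<notin> B'" using assms(2) by blast
  then obtain z where z: "forces z v" using V_element_forced by blast
  obtain a b where ab: "a \<in> A" "b \<in> B'" "z = a + b"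
    using full by (metis UNIV_I set_plus_elim)
  with assms have "b \<in> V_set" "- (b - z) \<in> U_set" by auto
  with z have "b = v" unfolding forces_def by blast
  with v ab(2) show False by blast
qed

theorem theorem3p3:
  fixes u :: "nat \<Rightarrow> int"
  assumes "strict_mono_on {1..} u"
    and "U_set = {- u i |i. 1 \<le> i}"
  shows "co_minimal_pair (\<Inter>i\<in>{1..}. greedy_prune U_set V_set u i) V_set"
proof -
  let ?L = "\<Inter>i\<in>{1..}. greedy_prune U_set V_set u i"
  have cover: "?L + V_set = UNIV"
    by (rule greedy_limit[OF U_plus_V finite_representations])
  have "?L \<subseteq> greedy_prune U_set V_set u 1" by blast
  then have sub: "?L \<subseteq> U_set" unfolding greedy_prune_1 .
  have "?L \<noteq> {}" "V_set \<noteq> {}"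
    using cover by (auto simp: set_plus_def)
  moreover have "A' + V_set \<subset> UNIV" if "A' \<subset> ?L" for A'
    using greedy_limit_minimal[OF assms(2) that] by (simp add: psubset_eq)
  moreover have "?L + B' \<subset> UNIV" if "B' \<subset> V_set" for B'
    using V_minimal[OF sub that] by (simp add: psubset_eq)
  ultimately show ?thesis
    unfolding co_minimal_pair_def using cover
    by (intro conjI allI impI) (simp_all only: not_False_eq_True)
qed

end
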